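(* Let $G$ be a finite group, and let $\chi(G)$ and $\omega(G)$ denote the chromatic number and the clique number of the power graph of $G$. Let $g \in G$ be an element such that $\Psi(o(g))$ is maximal among all values $\Psi(o(x))$, $x \in G$, where $o(x)$ is the order of $x$. Then \[\chi(G)=\omega(G)=\Psi(o(g)).\]
   Context: The power graph of a group $G$ is the undirected graph with vertex set $G$ in which two distinct elements $g,h$ are adjacent if and only if $g^k=h$ or $h^k=g$ for some positive integer $k$ (equivalently, one lies in the cyclic subgroup generated by the other). For a positive integer $n$, $\Psi(n)$ denotes the size of a largest clique in the power graph of the cyclic group of order $n$; explicitly, if $n=p_1^{\alpha_1}\cdots p_k^{\alpha_k}$ with primes $p_1<\dots<p_k$, then $\Psi(n)=1+\sum_{r=1}^{k}(p_r^{\alpha_r}-1)\prod_{j=r+1}^{k}p_j^{\alpha_j-1}(p_j-1)$. *)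

theory Defs
  imports "HOL-Algebra.Elementary_Groups" "HOL-Algebra.Multiplicative_Group" "HOL-Library.Ramsey"
begin

text \<open>Undirected graphs are given by a vertex set \<open>V\<close> and a set \<open>E\<close> of two-element
  edges; \<open>clique\<close> is the predicate of \<^theory>\<open>HOL-Library.Ramsey\<close>.\<close>

definition proper_colouring :: "'a set \<Rightarrow> 'a set set \<Rightarrow> nat \<Rightarrow> ('a \<Rightarrow> nat) \<Rightarrow> bool"
  where "proper_colouring V E k c \<longleftrightarrow>
    (\<forall>v\<in>V. c v < k) \<and> (\<forall>v\<in>V. \<forall>w\<in>V. {v, w} \<in> E \<longrightarrow> c v \<noteq> c w)"

text \<open>The two numbers below are meaningful for finite \<open>V\<close> only.\<close>

definition chromatic_number :: "'a set \<Rightarrow> 'a set set \<Rightarrow> nat"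
  where "chromatic_number V E = (LEAST k. \<exists>c. proper_colouring V E k c)"

definition clique_number :: "'a set \<Rightarrow> 'a set set \<Rightarrow> nat"
  where "clique_number V E = Max {card C |C. C \<subseteq> V \<and> clique C E}"

definition power_graph_edges :: "('a, 'b) monoid_scheme \<Rightarrow> 'a set set"
  where "power_graph_edges G =
    {{g, h} |g h. g \<in> carrier G \<and> h \<in> carrier G \<and> g \<noteq> h \<and>
       (\<exists>k::nat. k > 0 \<and> (g [^]\<^bsub>G\<^esub> k = h \<or> h [^]\<^bsub>G\<^esub> k = g))}"

text \<open>\<open>Psi n\<close> is used for \<open>n > 0\<close> only: \<^term>\<open>integer_mod_group 0\<close> is the infinite
  cyclic group.\<close>

definition Psi :: "nat \<Rightarrow> nat"
  where "Psi n =
    clique_number (carrier (integer_mod_group n)) (power_graph_edges (integer_mod_group n))"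

end

theory Submission
  imports Defs
begin

text \<open>The power graph is the comparability graph of the preorder ``\<open>u\<close> is a positive power of
  \<open>v\<close>''. Breaking ties inside the classes of mutually comparable vertices turns a finite preorder
  into a partial order with the same comparability graph, and colouring every vertex by its
  height shows that chromatic number and clique number agree. A clique of the power graph is a chain
  of the preorder, so all its members are powers of its greatest element \<open>x\<close>. It therefore lies in
  a copy of the cyclic group of order \<open>o(x)\<close>, and its size is at most \<open>\<Psi>(o(x))\<close>.\<close>

section \<open>Cliques and colourings of finite graphs\<close>

lemma finite_clique_cards:
  assumes "finite V"
  shows "finite {card C |C. C \<subseteq> V \<and> clique C E}"
  by (rule finite_subset[of _ "card ` Pow V"]) (use assms in auto)

lemma card_le_clique_number:
  assumes "finite V" "C \<subseteq> V" "clique C E"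
  shows "card C \<le> clique_number V E"
  unfolding clique_number_def
  by (rule Max_ge) (use assms finite_clique_cards in blast)+

lemma clique_number_attained:
  assumes "finite V"
  obtains C where "C \<subseteq> V" "clique C E" "card C = clique_number V E"
proof -
  have "{card C |C. C \<subseteq> V \<and> clique C E} \<noteq> {}"
    using null_clique[of E] by blast
  then have "clique_number V E \<in> {card C |C. C \<subseteq> V \<and> clique C E}"
    unfolding clique_number_def by (rule Max_in[OF finite_clique_cards[OF assms]])
  then show thesis
    using that by auto
qed

text \<open>Vertices of a clique get pairwise distinct colours, so a largest clique embeds into the
  \<open>k\<close> colours.\<close>

lemma clique_number_le_if_proper_colouring:
  assumes "finite V" "proper_colouring V E k c"
  shows "clique_number V E \<le> k"
proof -
  obtain C where C: "C \<subseteq> V" "clique C E" "card C = clique_number V E"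
    using clique_number_attained[OF assms(1)] .
  have "inj_on c C"
    using C(1,2) assms(2) unfolding proper_colouring_def clique_def inj_on_def by blast
  moreover have "c ` C \<subseteq> {..<k}"
    using C(1) assms(2) unfolding proper_colouring_def by auto
  ultimately show ?thesis
    using C(3) card_inj_on_le[of c C "{..<k}"] by simp
qed

text \<open>Mirsky's theorem (the dual of Dilworth's), carried over from orders to a transitive
  relation \<open>R\<close>.\<close>

lemma chromatic_number_comparability_graph:
  fixes R :: "'a \<Rightarrow> 'a \<Rightarrow> bool"
  assumes fin: "finite V"
    and trans: "transp_on V R"
    and edge: "\<And>u v. u \<in> V \<Longrightarrow> v \<in> V \<Longrightarrow> {u, v} \<in> E \<longleftrightarrow> u \<noteq> v \<and> (R u v \<or> R v u)"
  shows "chromatic_number V E = clique_number V E"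
proof -
  obtain f :: "'a \<Rightarrow> nat" where f: "inj_on f V"
    using finite_imp_inj_to_nat_seg[OF fin] by blast
  \<comment> \<open>\<open>f\<close> numbers the vertices arbitrarily; mutually related ones are
    ordered by their numbers, and since \<open>f u < f u\<close> fails, \<open>S\<close> is
    irreflexive even where \<open>R u u\<close> holds.\<close>
  define S where "S u v \<longleftrightarrow> R u v \<and> (R v u \<longrightarrow> f u < f v)" for u v
  have S_trans: "S u w" if "u \<in> V" "v \<in> V" "w \<in> V" "S u v" "S v w" for u v w
  proof -
    have "R u w"
      using transp_onD[OF trans, of u v w] that by (simp add: S_def)
    \<comment> \<open>A way back from \<open>w\<close> to \<open>u\<close> puts all three vertices
      in one class, where both tie-breaks apply and give \<open>f u < f v < f w\<close>.\<close>
    moreover have "R v u \<and> R w v" if "R w u"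
      using transp_onD[OF trans, of v w u] transp_onD[OF trans, of w u v]
        that \<open>u \<in> V\<close> \<open>v \<in> V\<close> \<open>w \<in> V\<close> \<open>S u v\<close> \<open>S v w\<close> by (simp add: S_def)
    ultimately show ?thesis
      using \<open>S u v\<close> \<open>S v w\<close> by (auto simp: S_def)
  qed
  have S_irrefl: "\<not> S u u" for u
    by (simp add: S_def)
  have edge_S: "{u, v} \<in> E \<longleftrightarrow> S u v \<or> S v u" if "u \<in> V" "v \<in> V" for u v
    using edge[OF that] inj_on_eq_iff[OF f that] nat_neq_iff[of "f u" "f v"]
    by (auto simp: S_def)
  define down where "down v = {u \<in> V. S u v}" for v
  \<comment> \<open>Cliques inside \<open>down v\<close> are the chains strictly below
    \<open>v\<close>, so \<open>c v\<close> is the height of \<open>v\<close>, starting at 0 for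
    minimal vertices.\<close>
  define c where "c v = clique_number (down v) E" for v
  have fin_down: "finite (down v)" for v
    using fin by (simp add: down_def)
  have clique_insert: "clique (insert v C) E" if "v \<in> V" "C \<subseteq> down v" "clique C E" for v C
    unfolding clique_def
  proof (intro ballI impI)
    fix a b
    assume "a \<in> insert v C" "b \<in> insert v C" "a \<noteq> b"
    moreover have "C \<subseteq> V" "\<forall>u\<in>C. S u v"
      using that(2) by (auto simp: down_def)
    ultimately show "{a, b} \<in> E"
      using that(1,3) edge_S[of a b] by (auto simp: clique_def)
  qed
  \<comment> \<open>Putting \<open>v\<close> on top of a largest chain below it makes the inequality
    strict. It is applied with \<open>W\<close> a larger down-set, for monotonicity, and with
    \<open>W = V\<close>, for the number of colours.\<close>
  have extend: "c v < clique_number W E"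
    if "v \<in> V" "finite W" "insert v (down v) \<subseteq> W" for v W
  proof -
    obtain C where C: "C \<subseteq> down v" "clique C E" "card C = c v"
      using clique_number_attained[OF fin_down] unfolding c_def by blast
    have "v \<notin> C"
      using C(1) S_irrefl unfolding down_def by blast
    then have "card (insert v C) = Suc (c v)"
      using C finite_subset[OF _ fin_down] by simp
    moreover have "card (insert v C) \<le> clique_number W E"
      using that(3) C(1)
      by (intro card_le_clique_number[OF that(2) _ clique_insert[OF that(1) C(1,2)]]) blast
    ultimately show ?thesis
      by simp
  qed
  have mono: "c u < c v" if "u \<in> V" "v \<in> V" "S u v" for u v
  proof -
    have "insert u (down u) \<subseteq> down v"
      using that S_trans[OF _ that(1,2) _ that(3)] unfolding down_def by blast
    then show ?thesis
      unfolding c_def[of v] by (rule extend[OF that(1) fin_down])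
  qed
  have "proper_colouring V E (clique_number V E) c"
    unfolding proper_colouring_def
  proof (intro conjI ballI impI)
    show "c v < clique_number V E" if "v \<in> V" for v
      by (rule extend[OF that fin]) (use that in \<open>auto simp: down_def\<close>)
    show "c v \<noteq> c w" if "v \<in> V" "w \<in> V" "{v, w} \<in> E" for v w
      using edge_S[of v w] mono[of v w] mono[of w v] that by auto
  qed
  then show ?thesis
    unfolding chromatic_number_def
    by (intro Least_equality) (auto intro: clique_number_le_if_proper_colouring[OF fin])
qed

section \<open>The power graph as a comparability graph\<close>

definition positive_power :: "('a, 'b) monoid_scheme \<Rightarrow> 'a \<Rightarrow> 'a \<Rightarrow> bool"
  where "positive_power G u v \<longleftrightarrow> (\<exists>k::nat. k > 0 \<and> v [^]\<^bsub>G\<^esub> k = u)"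

lemma power_graph_edge_iff:
  assumes "u \<in> carrier G" "v \<in> carrier G"
  shows "{u, v} \<in> power_graph_edges G \<longleftrightarrow>
    u \<noteq> v \<and> (positive_power G u v \<or> positive_power G v u)"
  using assms unfolding power_graph_edges_def positive_power_def
  by (auto simp: doubleton_eq_iff)

text \<open>Exponents multiply and stay positive. Adjacency is in general not transitive, hence the
  split into its two directions.\<close>

lemma (in monoid) transp_on_positive_power: "transp_on (carrier G) (positive_power G)"
proof (rule transp_onI)
  fix u v w
  assume "w \<in> carrier G" "positive_power G u v" "positive_power G v w"
  then show "positive_power G u w"
    unfolding positive_power_def by (metis nat_pow_pow nat_0_less_mult_iff)
qed

text \<open>A homomorphism preserves each equation \<open>v [^] k = u\<close>, and injectivity
  reflects it with the same exponent.\<close>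

lemma positive_power_inj_hom_iff:
  assumes "group H" "group G" "\<phi> \<in> hom H G" "inj_on \<phi> (carrier H)"
    and "u \<in> carrier H" "v \<in> carrier H"
  shows "positive_power G (\<phi> u) (\<phi> v) \<longleftrightarrow> positive_power H u v"
proof -
  interpret group_hom H G \<phi>
    using assms by (simp add: group_hom_def group_hom_axioms_def)
  have "\<phi> v [^]\<^bsub>G\<^esub> k = \<phi> u \<longleftrightarrow> v [^]\<^bsub>H\<^esub> k = u" for k :: nat
    using assms(4-6) by (metis H.nat_pow_closed G.nat_pow_closed hom_nat_pow inj_onD)
  then show ?thesis
    by (simp add: positive_power_def)
qed

text \<open>One direction pushes cliques of a cyclic group into \<open>G\<close>, the other pulls
  cliques of \<open>G\<close> back.\<close>

lemma clique_inj_hom_image_iff: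
  assumes "group H" "group G" "\<phi> \<in> hom H G" "inj_on \<phi> (carrier H)" "C \<subseteq> carrier H"
  shows "clique (\<phi> ` C) (power_graph_edges G) \<longleftrightarrow> clique C (power_graph_edges H)"
proof -
  have "(\<phi> u \<noteq> \<phi> v \<longrightarrow> {\<phi> u, \<phi> v} \<in> power_graph_edges G) \<longleftrightarrow>
      (u \<noteq> v \<longrightarrow> {u, v} \<in> power_graph_edges H)" if "u \<in> C" "v \<in> C" for u v
  proof -
    have uv: "u \<in> carrier H" "v \<in> carrier H"
      using that assms(5) by auto
    moreover have "\<phi> u \<in> carrier G" "\<phi> v \<in> carrier G"
      using uv assms(3) by (auto simp: hom_def)
    ultimately show ?thesis
      using positive_power_inj_hom_iff[OF assms(1-4)] inj_on_eq_iff[OF assms(4)]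
      by (simp add: power_graph_edge_iff)
  qed
  then show ?thesis
    unfolding clique_def by auto
qed

section \<open>Cyclic subgroups as copies of \<open>integer_mod_group\<close>\<close>

lemma (in group) int_pow_mod_ord:
  fixes k :: int
  assumes "x \<in> carrier G"
  shows "x [^] (k mod int (ord x)) = x [^] k"
  using assms by (simp add: int_pow_eq)

lemma (in group) int_pow_hom_integer_mod_group:
  assumes "x \<in> carrier G"
  shows "(\<lambda>k::int. x [^] k) \<in> hom (integer_mod_group (ord x)) G"
proof (rule homI)
  fix i j :: int
  show "x [^] (i \<otimes>\<^bsub>integer_mod_group (ord x)\<^esub> j) = x [^] i \<otimes> x [^] j"
    using assms by (simp add: int_pow_mod_ord int_pow_mult)
qed (use assms in auto)

text \<open>Equal powers have exponents congruent modulo \<open>ord x\<close>, and the carrier holds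
  one representative of each class. Infinite order is covered: then \<open>ord x = 0\<close> and
  congruence is equality.\<close>

lemma (in group) inj_on_int_pow_integer_mod_group:
  assumes "x \<in> carrier G"
  shows "inj_on (\<lambda>k::int. x [^] k) (carrier (integer_mod_group (ord x)))"
proof (rule inj_onI)
  fix i j :: int
  assume ij: "i \<in> carrier (integer_mod_group (ord x))" "j \<in> carrier (integer_mod_group (ord x))"
    and eq: "x [^] i = x [^] j"
  have "j mod int (ord x) = i mod int (ord x)"
    using eq assms by (simp add: int_pow_eq mod_eq_dvd_iff)
  then show "i = j"
    using ij by (auto simp: carrier_integer_mod_group split: if_splits)
qed

section \<open>Comparing the clique number with \<open>Psi\<close>\<close>

lemma (in group) Psi_ord_le_clique_number:
  assumes fin: "finite (carrier G)" and x: "x \<in> carrier G"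
  shows "Psi (ord x) \<le> clique_number (carrier G) (power_graph_edges G)"
proof -
  let ?Z = "integer_mod_group (ord x)" and ?\<phi> = "\<lambda>k::int. x [^] k"
  have "finite (carrier ?Z)"
    using ord_ge_1[OF fin x] by (simp add: carrier_integer_mod_group)
  then obtain C where C: "C \<subseteq> carrier ?Z" "clique C (power_graph_edges ?Z)" "card C = Psi (ord x)"
    using clique_number_attained unfolding Psi_def by metis
  have inj: "inj_on ?\<phi> (carrier ?Z)"
    using inj_on_int_pow_integer_mod_group[OF x] .
  have "clique (?\<phi> ` C) (power_graph_edges G)"
    using clique_inj_hom_image_iff[OF _ is_group int_pow_hom_integer_mod_group[OF x] inj C(1)] C(2)
    by simp
  then have "card (?\<phi> ` C) \<le> clique_number (carrier G) (power_graph_edges G)"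
    using fin x by (intro card_le_clique_number) auto
  then show ?thesis
    using C(3) card_image[OF inj_on_subset[OF inj C(1)]] by simp
qed

lemma (in group) clique_number_le_Psi_ord:
  assumes fin: "finite (carrier G)"
  obtains x where "x \<in> carrier G"
    "clique_number (carrier G) (power_graph_edges G) \<le> Psi (ord x)"
proof -
  obtain C where C: "C \<subseteq> carrier G" "clique C (power_graph_edges G)"
    "card C = clique_number (carrier G) (power_graph_edges G)"
    using clique_number_attained[OF fin] .
  show thesis
  \<comment> \<open>Only a nonempty chain has a greatest element.\<close>
  proof (cases "C = {}")
    case True
    then show thesis
      using that[OF one_closed] C(3) by simp
  next
    case False
    have "totalp_on C (positive_power G)"
      using C(1,2) by (intro totalp_onI) (auto simp: clique_def power_graph_edge_iff subset_iff)
    moreover have "transp_on C (positive_power G)"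
      using transp_on_positive_power C(1) by (rule transp_on_subset)
    ultimately obtain x where x: "x \<in> C" "\<And>y. y \<in> C \<Longrightarrow> y \<noteq> x \<Longrightarrow> positive_power G y x"
      using Finite_Set.bex_greatest_element[of C "positive_power G"] False
        finite_subset[OF C(1) fin] by blast
    have xG: "x \<in> carrier G"
      using x(1) C(1) by blast
    let ?Z = "integer_mod_group (ord x)" and ?\<phi> = "\<lambda>k::int. x [^] k"
    have inj: "inj_on ?\<phi> (carrier ?Z)"
      using inj_on_int_pow_integer_mod_group[OF xG] .
    have finZ: "finite (carrier ?Z)"
      using ord_ge_1[OF fin xG] by (simp add: carrier_integer_mod_group)
    have "y \<in> ?\<phi> ` carrier ?Z" if y: "y \<in> C" for y
    proof -
      \<comment> \<open>The greatest element is compared only with the other members of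
        \<open>C\<close>; for \<open>y = x\<close> the exponent is 1.\<close>
      obtain k :: nat where k: "x [^] k = y"
        using x(2)[OF y] nat_pow_eone[OF xG] unfolding positive_power_def by metis
      have "y = ?\<phi> (int k mod int (ord x))"
        using k xG by (simp add: int_pow_mod_ord int_pow_int)
      moreover have "int k mod int (ord x) \<in> carrier ?Z"
        using ord_ge_1[OF fin xG] by (simp add: carrier_integer_mod_group)
      ultimately show ?thesis
        by blast
    qed
    \<comment> \<open>\<open>C\<close> lies in the image of the cyclic group, so it can be pulled
      back to a clique \<open>D\<close> of the same size.\<close>
    then obtain D where D: "D \<subseteq> carrier ?Z" "C = ?\<phi> ` D"
      by (meson subsetI subset_imageE)
    have "clique D (power_graph_edges ?Z)"
      using clique_inj_hom_image_iff[OF _ is_group int_pow_hom_integer_mod_group[OF xG] inj D(1)]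
        C(2) D(2) by simp
    then have "card D \<le> Psi (ord x)"
      unfolding Psi_def using finZ D(1) by (intro card_le_clique_number)
    then show thesis
      using that[OF xG] C(3) D card_image[OF inj_on_subset[OF inj D(1)]] by simp
  qed
qed

theorem theorem1p4:
  fixes G :: "('a, 'b) monoid_scheme" and g :: 'a
  assumes "group G"
    and "finite (carrier G)"
    and "g \<in> carrier G"
    and "\<And>x. x \<in> carrier G \<Longrightarrow> Psi (group.ord G x) \<le> Psi (group.ord G g)"
  shows "chromatic_number (carrier G) (power_graph_edges G)
           = clique_number (carrier G) (power_graph_edges G)
       \<and> clique_number (carrier G) (power_graph_edges G) = Psi (group.ord G g)"
proof -
  interpret group G
    by fact
  obtain x where "x \<in> carrier G"
    "clique_number (carrier G) (power_graph_edges G) \<le> Psi (ord x)"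
    using clique_number_le_Psi_ord[OF assms(2)] .
  \<comment> \<open>The element \<open>x\<close> comes from a largest clique and may differ from
    \<open>g\<close>; maximality of \<open>g\<close> passes the bound on.\<close>
  then have "clique_number (carrier G) (power_graph_edges G) \<le> Psi (ord g)"
    using assms(4) le_trans by blast
  moreover have "chromatic_number (carrier G) (power_graph_edges G)
      = clique_number (carrier G) (power_graph_edges G)"
    using assms(2) transp_on_positive_power power_graph_edge_iff
    by (rule chromatic_number_comparability_graph)
  ultimately show ?thesis
    using Psi_ord_le_clique_number[OF assms(2,3)] by simp
qed

end
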